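(* The class of numerical monoids is globally closed. That is, if a numerical monoid $H$ is globally isomorphic to a semigroup $K$, then $K$ is isomorphic to a numerical monoid.
   Context: For a semigroup $S$ (written multiplicatively), $\mathcal P(S)$ denotes the semigroup of all non-empty subsets of $S$ under setwise multiplication $XY := \{xy : x \in X, y \in Y\}$ (for additively written $S$, the operation is $X + Y := \{x+y : x \in X, y \in Y\}$). A semigroup $H$ is globally isomorphic to a semigroup $K$ if there is a semigroup isomorphism $\mathcal P(H) \to \mathcal P(K)$. A class $\mathscr C$ of semigroups is globally closed if, whenever a semigroup $H \in \mathscr C$ is globally isomorphic to a semigroup $K$, there exists a semigroup $K' \in \mathscr C$ that is isomorphic to $K$. A numerical monoid is a submonoid of the additive monoid $\mathbb N$ of non-negative integers whose complement in $\mathbb N$ is finite. *)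

theory Defs
  imports "HOL-Algebra.Coset"
begin

text \<open>
  Semigroups are carried by the record type \<^typ>\<open>'a monoid\<close> of HOL-Algebra, so that
  \<^const>\<open>hom\<close>, \<^const>\<open>iso\<close>, \<^const>\<open>is_iso\<close> and \<^const>\<open>set_mult\<close> apply; none of these mentions
  the field \<^const>\<open>one\<close>, which is irrelevant for a semigroup and left unconstrained. In
  particular an isomorphism is a bijective multiplicative map between the carriers, not
  required to preserve identities.
\<close>

definition is_semigroup :: "'a monoid \<Rightarrow> bool" where
  "is_semigroup S \<longleftrightarrow>
    (\<forall>x\<in>carrier S. \<forall>y\<in>carrier S. x \<otimes>\<^bsub>S\<^esub> y \<in> carrier S) \<and>
    (\<forall>x\<in>carrier S. \<forall>y\<in>carrier S. \<forall>z\<in>carrier S.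
      (x \<otimes>\<^bsub>S\<^esub> y) \<otimes>\<^bsub>S\<^esub> z = x \<otimes>\<^bsub>S\<^esub> (y \<otimes>\<^bsub>S\<^esub> z))"

definition power_semigroup :: "'a monoid \<Rightarrow> 'a set monoid" where
  "power_semigroup S =
    \<lparr>carrier = {X. X \<subseteq> carrier S \<and> X \<noteq> {}}, mult = set_mult S, one = {\<one>\<^bsub>S\<^esub>}\<rparr>"

definition globally_isomorphic :: "'a monoid \<Rightarrow> 'b monoid \<Rightarrow> bool" where
  "globally_isomorphic H K \<longleftrightarrow> power_semigroup H \<cong> power_semigroup K"

text \<open>
  A class of semigroups with elements in \<^typ>\<open>'a\<close> is a set of records. The competing
  semigroup \<^term>\<open>K\<close> lives on an arbitrary carrier inside \<^typ>\<open>'k\<close>. HOL cannot quantify over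
  types inside a formula, so \<^typ>\<open>'k\<close> is a parameter, and a theorem about
  \<^term>\<open>TYPE('k)\<close> with a type variable \<^typ>\<open>'k\<close> covers all semigroups \<^term>\<open>K\<close>.
\<close>

definition globally_closed :: "'k itself \<Rightarrow> 'a monoid set \<Rightarrow> bool" where
  "globally_closed _ \<C> \<longleftrightarrow>
    (\<forall>H\<in>\<C>. \<forall>K :: 'k monoid. is_semigroup K \<longrightarrow> globally_isomorphic H K \<longrightarrow>
      (\<exists>K'\<in>\<C>. K' \<cong> K))"

definition nat_add_monoid :: "nat monoid" where
  "nat_add_monoid = \<lparr>carrier = UNIV, mult = (+), one = 0\<rparr>"

definition numerical_monoids :: "nat monoid set" where
  "numerical_monoids =
    {nat_add_monoid\<lparr>carrier := H\<rparr> | H. submonoid H nat_add_monoid \<and> finite (UNIV - H)}"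

lemma is_semigroup_power_semigroup:
  assumes "is_semigroup S"
  shows "is_semigroup (power_semigroup S)"
proof -
  have closed: "x \<otimes>\<^bsub>S\<^esub> y \<in> carrier S" if "x \<in> carrier S" "y \<in> carrier S" for x y
    using assms that unfolding is_semigroup_def by blast
  have assoc: "(x \<otimes>\<^bsub>S\<^esub> y) \<otimes>\<^bsub>S\<^esub> z = x \<otimes>\<^bsub>S\<^esub> (y \<otimes>\<^bsub>S\<^esub> z)"
    if "x \<in> carrier S" "y \<in> carrier S" "z \<in> carrier S" for x y z
    using assms that unfolding is_semigroup_def by blast
  have "(X <#>\<^bsub>S\<^esub> Y) <#>\<^bsub>S\<^esub> Z = X <#>\<^bsub>S\<^esub> (Y <#>\<^bsub>S\<^esub> Z)"
    if "X \<subseteq> carrier S" "Y \<subseteq> carrier S" "Z \<subseteq> carrier S" for X Y Z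
  proof -
    have "(X <#>\<^bsub>S\<^esub> Y) <#>\<^bsub>S\<^esub> Z = (\<Union>x\<in>X. \<Union>y\<in>Y. \<Union>z\<in>Z. {(x \<otimes>\<^bsub>S\<^esub> y) \<otimes>\<^bsub>S\<^esub> z})"
      unfolding set_mult_def by auto
    also have "\<dots> = (\<Union>x\<in>X. \<Union>y\<in>Y. \<Union>z\<in>Z. {x \<otimes>\<^bsub>S\<^esub> (y \<otimes>\<^bsub>S\<^esub> z)})"
      using that by (intro SUP_cong refl) (simp add: assoc subset_iff)
    also have "\<dots> = X <#>\<^bsub>S\<^esub> (Y <#>\<^bsub>S\<^esub> Z)"
      unfolding set_mult_def by auto
    finally show ?thesis .
  qed
  moreover have "X <#>\<^bsub>S\<^esub> Y \<subseteq> carrier S \<and> X <#>\<^bsub>S\<^esub> Y \<noteq> {}"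
    if "X \<subseteq> carrier S" "X \<noteq> {}" "Y \<subseteq> carrier S" "Y \<noteq> {}" for X Y
    using that closed unfolding set_mult_def by blast
  ultimately show ?thesis
    unfolding is_semigroup_def power_semigroup_def by simp
qed

lemma is_semigroup_numerical_monoid:
  assumes "M \<in> numerical_monoids"
  shows "is_semigroup M"
  using assms
  by (auto simp: numerical_monoids_def nat_add_monoid_def is_semigroup_def
      dest: submonoid.m_closed)

end

theory Submission
  imports Defs "HOL-Library.Set_Algebras"
begin

text \<open>
  Let \<open>f : P(H) \<rightarrow> P(K)\<close> be an isomorphism. A cancellative element of the power semigroup of a
  commutative semigroup is a singleton, so \<open>f {h} = {\<phi> h}\<close> for a map \<open>\<phi>\<close> that embeds \<open>H\<close> into \<open>K\<close>,
  and it remains to see that \<open>\<phi>\<close> is onto. Choose \<open>n\<close> with \<open>C = {n..} \<subseteq> H\<close> and put \<open>J = f C\<close>.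
  As \<open>X + C = min X + C\<close> for all \<open>X\<close>, we get \<open>x J = \<phi> h J\<close> whenever \<open>h\<close> is the minimum of the
  preimage of \<open>{x}\<close>. If \<open>\<phi> n \<in> J\<close>, then \<open>\<phi> (h + n) \<in> x J\<close>, so the preimage of \<open>{x}\<close> is a summand of
  the singleton \<open>{h + n}\<close>, hence itself a singleton.

  To see that \<open>\<phi> n \<in> J\<close>, take \<open>a \<in> J\<close> with preimage of least minimum. From \<open>J J = \<phi> n J\<close>
  this minimum is \<open>n\<close>, so \<open>a J = \<phi> n J\<close>, which yields \<open>b \<in> J\<close> with \<open>b b = \<phi> n b\<close>. If \<open>b \<noteq> \<phi> n\<close>,
  then the preimage \<open>V\<close> of \<open>{\<phi> n, b}\<close> satisfies \<open>V + V = n + V\<close>, hence is infinite, and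
  \<open>A + V = n + V\<close> for all \<open>A\<close> with \<open>n \<in> A \<subseteq> V\<close>; but all these \<open>A\<close> have \<open>f A \<subseteq> {\<phi> n, b}\<close>.
\<close>

section \<open>Cancellative elements of a power semigroup\<close>

lemma mem_set_mult: "z \<in> X <#>\<^bsub>S\<^esub> Y \<longleftrightarrow> (\<exists>x\<in>X. \<exists>y\<in>Y. z = x \<otimes>\<^bsub>S\<^esub> y)"
  by (auto simp: set_mult_def)

text \<open>If products of elements of \<open>U\<close> are not all equal, one of them can be
  deleted from \<open>U U\<close> without changing \<open>U (U U)\<close>, against cancellation. If
  they are all equal, then \<open>U U = U {a}\<close> for any \<open>a\<close> in \<open>U\<close>,
  and \<open>U\<close> cancels.\<close>

lemma cancellative_set_singleton:
  assumes S: "is_semigroup S"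
    and comm: "\<And>x y. x \<in> carrier S \<Longrightarrow> y \<in> carrier S \<Longrightarrow> x \<otimes>\<^bsub>S\<^esub> y = y \<otimes>\<^bsub>S\<^esub> x"
    and U: "U \<subseteq> carrier S" "U \<noteq> {}"
    and cancel: "\<And>Y Z. Y \<subseteq> carrier S \<Longrightarrow> Y \<noteq> {} \<Longrightarrow> Z \<subseteq> carrier S \<Longrightarrow> Z \<noteq> {} \<Longrightarrow>
      U <#>\<^bsub>S\<^esub> Y = U <#>\<^bsub>S\<^esub> Z \<Longrightarrow> Y = Z"
  shows "is_singleton U"
proof -
  note closed = S[unfolded is_semigroup_def, THEN conjunct1, rule_format]
  note assoc = S[unfolded is_semigroup_def, THEN conjunct2, rule_format]
  let ?UU = "U <#>\<^bsub>S\<^esub> U"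
  have UU: "?UU \<subseteq> carrier S" "?UU \<noteq> {}"
    using U closed by (auto simp: set_mult_def)
  have const: "a \<otimes>\<^bsub>S\<^esub> a = a \<otimes>\<^bsub>S\<^esub> b \<and> b \<otimes>\<^bsub>S\<^esub> b = a \<otimes>\<^bsub>S\<^esub> b"
    if a: "a \<in> U" and b: "b \<in> U" for a b
  proof (rule ccontr)
    assume neq: "\<not> ?thesis"
    have aS: "a \<in> carrier S" and bS: "b \<in> carrier S"
      using a b U by auto
    let ?t = "a \<otimes>\<^bsub>S\<^esub> b"
    let ?Y = "?UU - {?t}"
    have mem: "u \<otimes>\<^bsub>S\<^esub> v \<in> ?UU" if "u \<in> U" "v \<in> U" for u v
      using that by (auto simp: set_mult_def)
    have Yne: "?Y \<noteq> {}"
      using neq mem[OF a a] mem[OF b b] by auto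
    have prod: "u \<otimes>\<^bsub>S\<^esub> (v \<otimes>\<^bsub>S\<^esub> w) \<in> U <#>\<^bsub>S\<^esub> ?Y"
      if "u \<in> U" "v \<in> U" "w \<in> U" "v \<otimes>\<^bsub>S\<^esub> w \<noteq> ?t" for u v w
    proof -
      have "v \<otimes>\<^bsub>S\<^esub> w \<in> ?Y"
        using that mem by simp
      then show ?thesis
        using that(1) unfolding mem_set_mult[of _ S U ?Y] by blast
    qed
    have "u \<otimes>\<^bsub>S\<^esub> ?t \<in> U <#>\<^bsub>S\<^esub> ?Y" if u: "u \<in> U" for u
    proof -
      have uS: "u \<in> carrier S"
        using u U by auto
      \<comment> \<open>Regrouping the triple product avoids \<open>?t\<close> unless both
        \<open>b u\<close> and \<open>a u\<close> equal \<open>?t\<close>. In that case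
        \<open>u ?t = a ?t = b ?t\<close>, and a square \<open>a a\<close> or \<open>b b\<close>
        different from \<open>?t\<close> can be split off instead.\<close>
      have e1: "u \<otimes>\<^bsub>S\<^esub> ?t = a \<otimes>\<^bsub>S\<^esub> (b \<otimes>\<^bsub>S\<^esub> u)"
        using assoc[OF aS bS uS] comm[OF uS closed[OF aS bS]] by simp
      have e2: "u \<otimes>\<^bsub>S\<^esub> ?t = b \<otimes>\<^bsub>S\<^esub> (a \<otimes>\<^bsub>S\<^esub> u)"
        using assoc[OF bS aS uS] comm[OF uS closed[OF aS bS]] comm[OF aS bS] by simp
      consider "b \<otimes>\<^bsub>S\<^esub> u \<noteq> ?t" | "a \<otimes>\<^bsub>S\<^esub> u \<noteq> ?t"
        | "b \<otimes>\<^bsub>S\<^esub> u = ?t" "a \<otimes>\<^bsub>S\<^esub> u = ?t" "a \<otimes>\<^bsub>S\<^esub> a \<noteq> ?t"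
        | "b \<otimes>\<^bsub>S\<^esub> u = ?t" "a \<otimes>\<^bsub>S\<^esub> u = ?t" "b \<otimes>\<^bsub>S\<^esub> b \<noteq> ?t"
        using neq by blast
      then show ?thesis
      proof cases
        case 1
        then show ?thesis using prod[OF a b u] e1 by simp
      next
        case 2
        then show ?thesis using prod[OF b a u] e2 by simp
      next
        case 3
        then have "u \<otimes>\<^bsub>S\<^esub> ?t = b \<otimes>\<^bsub>S\<^esub> (a \<otimes>\<^bsub>S\<^esub> a)"
          using e1 assoc[OF aS aS bS] comm[OF bS closed[OF aS aS]] by simp
        then show ?thesis using prod[OF b a a] 3 by simp
      next
        case 4
        then have "u \<otimes>\<^bsub>S\<^esub> ?t = a \<otimes>\<^bsub>S\<^esub> (b \<otimes>\<^bsub>S\<^esub> b)"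
          using e2 assoc[OF bS aS bS] assoc[OF aS bS bS] comm[OF aS bS] by simp
        then show ?thesis using prod[OF a b b] 4 by simp
      qed
    qed
    then have "u \<otimes>\<^bsub>S\<^esub> (v \<otimes>\<^bsub>S\<^esub> w) \<in> U <#>\<^bsub>S\<^esub> ?Y" if "u \<in> U" "v \<in> U" "w \<in> U" for u v w
      using prod that by metis
    then have "U <#>\<^bsub>S\<^esub> ?UU \<subseteq> U <#>\<^bsub>S\<^esub> ?Y"
      by (auto simp: mem_set_mult[of _ S U ?UU] mem_set_mult[of _ S U U] simp del: Diff_iff)
    moreover have "U <#>\<^bsub>S\<^esub> ?Y \<subseteq> U <#>\<^bsub>S\<^esub> ?UU"
      by (intro mono_set_mult) auto
    ultimately have "?Y = ?UU"
      using cancel[of ?Y ?UU] UU Yne by auto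
    then show False
      using mem[OF a b] by blast
  qed
  obtain a where a: "a \<in> U"
    using U by auto
  have eq: "u \<otimes>\<^bsub>S\<^esub> v = a \<otimes>\<^bsub>S\<^esub> a" if "u \<in> U" "v \<in> U" for u v
    using const[OF that] const[OF a that(1)] by metis
  have "U <#>\<^bsub>S\<^esub> W = (\<Union>u\<in>U. \<Union>w\<in>W. {a \<otimes>\<^bsub>S\<^esub> a})" if "W \<subseteq> U" for W
    unfolding set_mult_def using that eq by (intro SUP_cong refl) auto
  from this[of U] this[of "{a}"] have "U <#>\<^bsub>S\<^esub> U = U <#>\<^bsub>S\<^esub> {a}"
    using U(2) a by simp
  then have "U = {a}"
    using U a by (intro cancel[of U "{a}"]) auto
  then show ?thesis
    by simp
qed

section \<open>Minima and tails in sumsets of naturals\<close>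

lemma set_plus_nonempty: "X \<noteq> {} \<Longrightarrow> Y \<noteq> {} \<Longrightarrow> X + Y \<noteq> {}"
  unfolding set_plus_def by blast

lemma Least_eq [simp]: "(LEAST x. x = (a :: nat)) = a"
  by (simp add: Least_equality)

lemma Least_mem: "X \<noteq> {} \<Longrightarrow> (LEAST x. x \<in> X) \<in> (X :: nat set)"
  by (auto intro: LeastI)

lemma Least_mem_atLeast: "(LEAST x. x \<in> {a :: nat..}) = a"
  by (rule Least_equality) auto

lemma Least_mem_set_plus:
  fixes X Y :: "nat set"
  assumes "X \<noteq> {}" "Y \<noteq> {}"
  shows "(LEAST z. z \<in> X + Y) = (LEAST x. x \<in> X) + (LEAST y. y \<in> Y)"
proof (rule Least_equality)
  show "(LEAST x. x \<in> X) + (LEAST y. y \<in> Y) \<in> X + Y"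
    using assms by (intro set_plus_intro Least_mem)
next
  fix z assume "z \<in> X + Y"
  then show "(LEAST x. x \<in> X) + (LEAST y. y \<in> Y) \<le> z"
    by (auto elim!: set_plus_elim intro!: add_mono Least_le)
qed

text \<open>Any excess of \<open>x\<close> over the minimum can be moved into the second summand,
  which stays in the tail.\<close>

lemma set_plus_atLeast:
  fixes X :: "nat set"
  assumes "X \<noteq> {}"
  shows "X + {n..} = {LEAST x. x \<in> X} + {n..}"
proof -
  let ?m = "LEAST x. x \<in> X"
  have "x + y \<in> {?m} + {n..}" if "x \<in> X" "n \<le> y" for x y
  proof -
    have "?m \<le> x" using that by (simp add: Least_le)
    then have "x + y = ?m + (x - ?m + y)" by simp
    then show ?thesis using that by (metis atLeast_iff insertI1 set_plus_intro trans_le_add2)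
  qed
  moreover have "?m \<in> X"
    using assms by (rule Least_mem)
  ultimately show ?thesis
    by (auto elim!: set_plus_elim intro: set_plus_intro)
qed

section \<open>The isomorphism, its inverse and commutativity of \<open>K\<close>\<close>

locale numerical_global_isomorphism =
  fixes H :: "nat set" and K :: "'k monoid" and f :: "nat set \<Rightarrow> 'k set"
  assumes add_mem: "\<And>x y. x \<in> H \<Longrightarrow> y \<in> H \<Longrightarrow> x + y \<in> H"
    and cofinite: "finite (UNIV - H)"
    and semigroup: "is_semigroup K"
    and bij: "bij_betw f {X. X \<subseteq> H \<and> X \<noteq> {}} {X. X \<subseteq> carrier K \<and> X \<noteq> {}}"
    and f_plus: "\<And>X Y. X \<subseteq> H \<Longrightarrow> X \<noteq> {} \<Longrightarrow> Y \<subseteq> H \<Longrightarrow> Y \<noteq> {} \<Longrightarrow> f (X + Y) = f X <#>\<^bsub>K\<^esub> f Y"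
begin

definition g :: "'k set \<Rightarrow> nat set" where
  "g = the_inv_into {X. X \<subseteq> H \<and> X \<noteq> {}} f"

lemmas closed = semigroup[unfolded is_semigroup_def, THEN conjunct1, rule_format]
lemmas assoc = semigroup[unfolded is_semigroup_def, THEN conjunct2, rule_format]

lemma plus_closed: "X \<subseteq> H \<Longrightarrow> Y \<subseteq> H \<Longrightarrow> X + Y \<subseteq> H"
  by (auto elim!: set_plus_elim intro: add_mem)

lemma f_closed:
  assumes "X \<subseteq> H" "X \<noteq> {}"
  shows "f X \<subseteq> carrier K" "f X \<noteq> {}"
  using bij_betw_apply[OF bij, of X] assms by simp_all

lemma f_inject:
  assumes "X \<subseteq> H" "X \<noteq> {}" "Y \<subseteq> H" "Y \<noteq> {}"
  shows "f X = f Y \<longleftrightarrow> X = Y"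
  using inj_on_eq_iff[OF bij_betw_imp_inj_on[OF bij], of X Y] assms by simp

lemma g_closed:
  assumes "A \<subseteq> carrier K" "A \<noteq> {}"
  shows "g A \<subseteq> H" "g A \<noteq> {}"
  using bij_betw_apply[OF bij_betw_the_inv_into[OF bij], of A] assms unfolding g_def by simp_all

lemma f_g: "A \<subseteq> carrier K \<Longrightarrow> A \<noteq> {} \<Longrightarrow> f (g A) = A"
  using f_the_inv_into_f_bij_betw[OF bij, of A] unfolding g_def by simp

lemma g_f: "X \<subseteq> H \<Longrightarrow> X \<noteq> {} \<Longrightarrow> g (f X) = X"
  using the_inv_into_f_f[OF bij_betw_imp_inj_on[OF bij], of X] unfolding g_def by simp

lemma g_mult:
  assumes "A \<subseteq> carrier K" "A \<noteq> {}" "B \<subseteq> carrier K" "B \<noteq> {}"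
  shows "g (A <#>\<^bsub>K\<^esub> B) = g A + g B"
proof -
  have "f (g A + g B) = A <#>\<^bsub>K\<^esub> B"
    using f_plus[OF g_closed g_closed] f_g assms by simp
  moreover have "g A + g B \<subseteq> H" "g A + g B \<noteq> {}"
    using plus_closed[OF g_closed(1) g_closed(1)] set_plus_nonempty[OF g_closed(2) g_closed(2)]
      assms by blast+
  ultimately show ?thesis
    by (metis g_f)
qed

text \<open>Commutativity of set addition passes through \<open>f\<close>, and singletons of
  \<open>K\<close> multiply like their elements.\<close>

lemma comm:
  assumes "x \<in> carrier K" "y \<in> carrier K"
  shows "x \<otimes>\<^bsub>K\<^esub> y = y \<otimes>\<^bsub>K\<^esub> x"
proof -
  have "{x} <#>\<^bsub>K\<^esub> {y} = f (g {x} + g {y})"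
    using assms f_plus[OF g_closed g_closed] f_g by simp
  also have "\<dots> = {y} <#>\<^bsub>K\<^esub> {x}"
    using assms f_plus[OF g_closed g_closed] f_g by (subst add.commute) simp
  finally show ?thesis
    by (simp add: set_mult_def)
qed

text \<open>Translation by \<open>h\<close> is injective on sets of naturals; \<open>f\<close>
  carries this over to \<open>K\<close>.\<close>

lemma f_cancel:
  assumes h: "h \<in> H" and Y: "Y \<subseteq> carrier K" "Y \<noteq> {}" and Z: "Z \<subseteq> carrier K" "Z \<noteq> {}"
    and eq: "f {h} <#>\<^bsub>K\<^esub> Y = f {h} <#>\<^bsub>K\<^esub> Z"
  shows "Y = Z"
proof -
  have "{h} + g Y = {h} + g Z"
    using arg_cong[OF eq, of g] g_mult f_closed[of "{h}"] g_f[of "{h}"] h Y Z by simp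
  then have "(+) h ` g Y = (+) h ` g Z"
    by (auto simp: set_plus_def)
  then have "g Y = g Z"
    by (simp add: inj_image_eq_iff)
  then show ?thesis
    using f_g Y Z by metis
qed

section \<open>The embedding of \<open>H\<close> into \<open>K\<close>\<close>

definition \<phi> :: "nat \<Rightarrow> 'k" where
  "\<phi> h = the_elem (f {h})"

lemma f_singleton:
  assumes "h \<in> H"
  shows "f {h} = {\<phi> h}"
proof -
  have "is_singleton (f {h})"
  proof (rule cancellative_set_singleton[OF semigroup comm])
    show "f {h} \<subseteq> carrier K" "f {h} \<noteq> {}"
      using f_closed[of "{h}"] assms by simp_all
  qed (assumption | rule f_cancel[OF assms])+
  then show ?thesis
    unfolding \<phi>_def by (simp add: is_singleton_the_elem)
qed

lemma \<phi>_closed: "h \<in> H \<Longrightarrow> \<phi> h \<in> carrier K"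
  using f_closed[of "{h}"] f_singleton by simp

lemma g_\<phi>: "h \<in> H \<Longrightarrow> g {\<phi> h} = {h}"
  using g_f[of "{h}"] f_singleton by simp

lemma \<phi>_add: "h \<in> H \<Longrightarrow> k \<in> H \<Longrightarrow> \<phi> (h + k) = \<phi> h \<otimes>\<^bsub>K\<^esub> \<phi> k"
  using f_plus[of "{h}" "{k}"] f_singleton add_mem by (simp add: set_plus_def set_mult_def)

lemma \<phi>_cancel:
  assumes "h \<in> H" "x \<in> carrier K" "y \<in> carrier K" "\<phi> h \<otimes>\<^bsub>K\<^esub> x = \<phi> h \<otimes>\<^bsub>K\<^esub> y"
  shows "x = y"
  using f_cancel[of h "{x}" "{y}"] assms f_singleton by (simp add: set_mult_def)

text \<open>The preimages \<open>g {x}\<close> are not yet known to be singletons, so their minima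
  stand in for their elements. Since minima add in sumsets, \<open>\<mu>\<close> is a homomorphism,
  and it is a left inverse of \<open>\<phi>\<close>.\<close>

definition \<mu> :: "'k \<Rightarrow> nat" where
  "\<mu> x = (LEAST h. h \<in> g {x})"

lemma \<mu>_mem: "x \<in> carrier K \<Longrightarrow> \<mu> x \<in> g {x}"
  unfolding \<mu>_def by (intro Least_mem g_closed) auto

lemma \<mu>_closed: "x \<in> carrier K \<Longrightarrow> \<mu> x \<in> H"
  using \<mu>_mem g_closed(1)[of "{x}"] by auto

lemma \<mu>_mult:
  assumes "x \<in> carrier K" "y \<in> carrier K"
  shows "\<mu> (x \<otimes>\<^bsub>K\<^esub> y) = \<mu> x + \<mu> y"
proof -
  have "g {x \<otimes>\<^bsub>K\<^esub> y} = g {x} + g {y}"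
    using g_mult[of "{x}" "{y}"] assms by (simp add: set_mult_def)
  then show ?thesis
    using Least_mem_set_plus g_closed assms unfolding \<mu>_def by simp
qed

lemma \<mu>_\<phi>: "h \<in> H \<Longrightarrow> \<mu> (\<phi> h) = h"
  unfolding \<mu>_def by (simp add: g_\<phi>)

lemma \<phi>_inj: "inj_on \<phi> H"
  by (rule inj_on_inverseI[of _ \<mu>]) (rule \<mu>_\<phi>)

text \<open>Only elements \<open>\<phi> h\<close> are known to be cancellable, so \<open>b\<close>
  cannot be cancelled directly. Instead, a preimage \<open>?V\<close> of \<open>?B\<close> other
  than \<open>{n}\<close> would have too many subsets whose images lie in the at most two-element
  set \<open>?B\<close>.\<close>

lemma square_eq_\<phi>_mult:
  assumes n: "n \<in> H" and b: "b \<in> carrier K" and bb: "b \<otimes>\<^bsub>K\<^esub> b = \<phi> n \<otimes>\<^bsub>K\<^esub> b"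
  shows "b = \<phi> n"
proof -
  let ?B = "{\<phi> n, b}"
  let ?V = "g ?B"
  note \<phi>n = \<phi>_closed[OF n]
  have B: "?B \<subseteq> carrier K" "?B \<noteq> {}"
    using b \<phi>n by auto
  note V = g_closed[OF B]
  have "?B <#>\<^bsub>K\<^esub> ?B = {\<phi> n} <#>\<^bsub>K\<^esub> ?B"
    using bb comm[OF b \<phi>n] by (auto simp: set_mult_def)
  then have VV: "?V + ?V = {n} + ?V"
    using g_mult[OF B B] g_mult[OF _ _ B, of "{\<phi> n}"] \<phi>n g_\<phi>[OF n] by simp
  define m where "m = (LEAST v. v \<in> ?V)"
  have "m + m = (LEAST z. z \<in> ?V + ?V)"
    unfolding m_def by (rule Least_mem_set_plus[OF V(2) V(2), symmetric])
  also have "\<dots> = (LEAST x. x \<in> {n}) + m"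
    unfolding m_def VV by (rule Least_mem_set_plus[OF insert_not_empty V(2)])
  finally have "m + m = n + m"
    by simp
  moreover have "m \<in> ?V"
    using V(2) unfolding m_def by (rule Least_mem)
  ultimately have nV: "n \<in> ?V" and mn: "m = n"
    by simp_all
  have ge: "n \<le> v" if "v \<in> ?V" for v
    using Least_le[of "\<lambda>v. v \<in> ?V", OF that] unfolding m_def[symmetric] mn .
  \<comment> \<open>Shifted down by \<open>n\<close>, the set \<open>?V\<close> is closed under
    addition, so one element \<open>n + d\<close> of \<open>?V\<close> yields
    \<open>n + 2 * d\<close> and \<open>n + 3 * d\<close>.\<close>
  have step: "v + w - n \<in> ?V" if "v \<in> ?V" "w \<in> ?V" for v w
  proof -
    have "v + w \<in> {n} + ?V"
      using set_plus_intro[OF that] unfolding VV .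
    then obtain z where "z \<in> ?V" "v + w = n + z"
      by (elim set_plus_elim) blast
    then show ?thesis
      by simp
  qed
  \<comment> \<open>The sum \<open>A + ?V\<close> is squeezed between \<open>{n} + ?V\<close> and
    \<open>?V + ?V\<close>, which coincide. After applying \<open>f\<close>, the factor
    \<open>\<phi> n\<close> cancels.\<close>
  have sub: "f A \<subseteq> ?B" if A: "n \<in> A" "A \<subseteq> ?V" for A
  proof
    fix y assume y: "y \<in> f A"
    have AH: "A \<subseteq> H" "A \<noteq> {}"
      using A V by auto
    have "A + ?V = {n} + ?V"
    proof
      show "A + ?V \<subseteq> {n} + ?V"
        unfolding VV[symmetric] by (rule set_plus_mono2[OF A(2) order_refl])
      show "{n} + ?V \<subseteq> A + ?V"
        using A(1) by (intro set_plus_mono2) auto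
    qed
    then have "f A <#>\<^bsub>K\<^esub> ?B = {\<phi> n} <#>\<^bsub>K\<^esub> ?B"
      using f_plus[OF AH V] f_plus[OF _ _ V, of "{n}"] n f_g[OF B] f_singleton[OF n] by simp
    moreover have yK: "y \<in> carrier K"
      using y f_closed[OF AH] by auto
    moreover have "y \<otimes>\<^bsub>K\<^esub> \<phi> n \<in> f A <#>\<^bsub>K\<^esub> ?B"
      using y by (auto simp: set_mult_def)
    ultimately have "\<phi> n \<otimes>\<^bsub>K\<^esub> y \<in> {\<phi> n} <#>\<^bsub>K\<^esub> ?B"
      using comm[OF yK \<phi>n] by simp
    then show "y \<in> ?B"
      using \<phi>_cancel[OF n yK] b \<phi>n by (auto simp: set_mult_def)
  qed
  have fV: "f ?V = ?B"
    using f_g[OF B] .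
  have "?V = {n}"
  proof (rule ccontr)
    assume "?V \<noteq> {n}"
    then obtain v where v: "v \<in> ?V" "v \<noteq> n"
      using nV by auto
    define d where "d = v - n"
    have d: "d > 0" "v = n + d"
      using v ge[of v] unfolding d_def by auto
    have V1: "n + d \<in> ?V" using v d by simp
    have V2: "n + 2 * d \<in> ?V" using step[OF V1 V1] by (simp add: mult_2 add_ac)
    have "n + d + (n + 2 * d) - n = n + 3 * d" by simp
    then have V3: "n + 3 * d \<in> ?V" using step[OF V1 V2] by simp
    \<comment> \<open>Of the nonempty subsets of \<open>?B\<close>, injectivity of \<open>f\<close>
      excludes \<open>{\<phi> n} = f {n}\<close> and \<open>?B = f ?V\<close>; the element
      \<open>n + 3 * d\<close> witnesses that \<open>{n, w}\<close> is not all of \<open>?V\<close>.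
      Two choices of \<open>w\<close> then collide.\<close>
    have fb: "f {n, w} = {b}" if w: "w \<in> ?V" "w \<noteq> n" "w \<noteq> n + 3 * d" for w
    proof -
      let ?A = "{n, w}"
      have A: "?A \<subseteq> ?V" using nV w by simp
      then have AH: "?A \<subseteq> H" using V(1) by (rule subset_trans)
      have "?A \<noteq> {n}" using w by auto
      then have ne: "f ?A \<noteq> {\<phi> n}"
        using f_inject[OF AH, of "{n}"] n f_singleton[OF n] by simp
      have "n + 3 * d \<notin> ?A"
        using d(1) w by simp
      then have "?A \<noteq> ?V"
        using V3 by metis
      then have "f ?A \<noteq> ?B"
        using f_inject[OF AH _ V] fV by simp
      then show ?thesis
        using ne sub[OF _ A] f_closed(2)[OF AH] by blast
    qed
    have "f {n, n + d} = f {n, n + 2 * d}"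
      using fb[OF V1] fb[OF V2] d(1) by simp
    moreover have "{n, n + d} \<subseteq> H" "{n, n + 2 * d} \<subseteq> H"
      using nV V1 V2 V by auto
    ultimately have "{n, n + d} = {n, n + 2 * d}"
      using f_inject by (metis insert_not_empty)
    then show False
      using d(1) by (simp add: doubleton_eq_iff)
  qed
  then have "?B = {\<phi> n}"
    using fV f_singleton[OF n] by metis
  then show ?thesis
    by blast
qed

section \<open>Surjectivity of the embedding\<close>

lemma \<phi>_surj: "\<phi> ` H = carrier K"
proof
  show "\<phi> ` H \<subseteq> carrier K"
    using \<phi>_closed by auto
next
  obtain n where "\<forall>x\<in>UNIV - H. x < n"
    using cofinite by (metis finite_nat_set_iff_bounded)
  then have C: "{n..} \<subseteq> H" "{n..} \<noteq> {}"
    by (auto simp: not_less[symmetric])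
  then have n: "n \<in> H" by auto
  note \<phi>n = \<phi>_closed[OF n]
  define J where "J = f {n..}"
  have J: "J \<subseteq> carrier K" "J \<noteq> {}"
    using f_closed[OF C] unfolding J_def by auto
  have xJ: "{x} <#>\<^bsub>K\<^esub> J = {\<phi> (\<mu> x)} <#>\<^bsub>K\<^esub> J" if x: "x \<in> carrier K" for x
    using f_plus[OF g_closed C, of "{x}"] f_plus[OF _ _ C, of "{\<mu> x}"] f_g[of "{x}"]
      set_plus_atLeast[OF g_closed(2), of "{x}"] x \<mu>_closed[OF x] f_singleton
    unfolding J_def \<mu>_def[symmetric] by simp
  have "{n..} + {n..} = {n} + {n..}"
    using set_plus_atLeast[OF C(2), of n] unfolding Least_mem_atLeast .
  then have JJ: "J <#>\<^bsub>K\<^esub> J = {\<phi> n} <#>\<^bsub>K\<^esub> J"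
    using f_plus[OF C C] f_plus[OF _ _ C, of "{n}"] n f_singleton[OF n] unfolding J_def by simp
  obtain a where a: "a \<in> J" and least: "\<And>y. y \<in> J \<Longrightarrow> \<mu> a \<le> \<mu> y"
    using ex_has_least_nat[of "\<lambda>x. x \<in> J" _ \<mu>] J(2) by auto
  have aK: "a \<in> carrier K" using a J by auto
  \<comment> \<open>The two inclusions of \<open>JJ\<close> give one inequality each:
    \<open>n + \<mu> a\<close> is a sum of two values of \<open>\<mu>\<close> on \<open>J\<close>,
    and \<open>\<mu> a + \<mu> a\<close> is \<open>n\<close> plus one such value.\<close>
  have "\<mu> a = n"
  proof (rule antisym)
    have "\<phi> n \<otimes>\<^bsub>K\<^esub> a \<in> J <#>\<^bsub>K\<^esub> J"
      unfolding JJ using a by (auto simp: set_mult_def)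
    then obtain x y where xy: "x \<in> J" "y \<in> J" "\<phi> n \<otimes>\<^bsub>K\<^esub> a = x \<otimes>\<^bsub>K\<^esub> y"
      by (auto simp: set_mult_def)
    then have "n + \<mu> a = \<mu> x + \<mu> y"
      using \<mu>_mult[of x y] \<mu>_mult[OF \<phi>n aK] \<mu>_\<phi>[OF n] J by auto
    then show "\<mu> a \<le> n"
      using least xy by (metis add_le_mono add_le_cancel_right)
  next
    have "a \<otimes>\<^bsub>K\<^esub> a \<in> {\<phi> n} <#>\<^bsub>K\<^esub> J"
      unfolding JJ[symmetric] using a by (auto simp: set_mult_def)
    then obtain x where x: "x \<in> J" "a \<otimes>\<^bsub>K\<^esub> a = \<phi> n \<otimes>\<^bsub>K\<^esub> x"
      by (auto simp: set_mult_def)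
    then have "\<mu> a + \<mu> a = n + \<mu> x"
      using \<mu>_mult[OF aK aK] \<mu>_mult[OF \<phi>n, of x] \<mu>_\<phi>[OF n] J by auto
    then show "n \<le> \<mu> a"
      using least[OF x(1)] by simp
  qed
  then have div: "\<exists>y\<in>J. \<phi> n \<otimes>\<^bsub>K\<^esub> x = a \<otimes>\<^bsub>K\<^esub> y" if "x \<in> J" for x
    using xJ[OF aK] that by (auto simp: set_mult_def set_eq_iff)
  \<comment> \<open>Cancelling \<open>a\<close> would give \<open>b = \<phi> n\<close>, but
    \<open>a\<close> is not known to be cancellable. Dividing once more by \<open>a\<close> allows
    \<open>\<phi> n b b = a c b = a b c = \<phi> n a c = \<phi> n \<phi> n b\<close>, where only
    \<open>\<phi> n\<close> has to be cancelled.\<close>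
  obtain b where b: "b \<in> J" "\<phi> n \<otimes>\<^bsub>K\<^esub> a = a \<otimes>\<^bsub>K\<^esub> b"
    using div[OF a] by auto
  obtain c where c: "c \<in> J" "\<phi> n \<otimes>\<^bsub>K\<^esub> b = a \<otimes>\<^bsub>K\<^esub> c"
    using div[OF b(1)] by auto
  have bK: "b \<in> carrier K" and cK: "c \<in> carrier K"
    using b c J by auto
  have "\<phi> n \<otimes>\<^bsub>K\<^esub> (b \<otimes>\<^bsub>K\<^esub> b) = (a \<otimes>\<^bsub>K\<^esub> c) \<otimes>\<^bsub>K\<^esub> b"
    using assoc[OF \<phi>n bK bK] c by simp
  also have "\<dots> = (a \<otimes>\<^bsub>K\<^esub> b) \<otimes>\<^bsub>K\<^esub> c"
    using assoc[OF aK cK bK] assoc[OF aK bK cK] comm[OF bK cK] by simp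
  also have "\<dots> = \<phi> n \<otimes>\<^bsub>K\<^esub> (\<phi> n \<otimes>\<^bsub>K\<^esub> b)"
    using b c assoc[OF \<phi>n aK cK] by simp
  finally have "b \<otimes>\<^bsub>K\<^esub> b = \<phi> n \<otimes>\<^bsub>K\<^esub> b"
    using \<phi>_cancel[OF n] closed \<phi>n bK by blast
  then have \<phi>nJ: "\<phi> n \<in> J"
    using square_eq_\<phi>_mult[OF n bK] b by simp
  show "carrier K \<subseteq> \<phi> ` H"
  proof
    fix x assume x: "x \<in> carrier K"
    note \<mu>H = \<mu>_closed[OF x]
    have "\<phi> (\<mu> x + n) \<in> {x} <#>\<^bsub>K\<^esub> J"
      unfolding xJ[OF x] using \<phi>nJ \<phi>_add[OF \<mu>H n] by (auto simp: set_mult_def)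
    then obtain y where y: "y \<in> J" "\<phi> (\<mu> x + n) = x \<otimes>\<^bsub>K\<^esub> y"
      by (auto simp: set_mult_def)
    have yK: "y \<in> carrier K" using y J by auto
    \<comment> \<open>A sumset is a singleton only if both summands are.\<close>
    have "{\<mu> x + n} = g {x} + g {y}"
      using g_mult[of "{x}" "{y}"] x yK y(2) g_\<phi>[OF add_mem[OF \<mu>H n]]
      by (simp add: set_mult_def)
    then have sum: "u + v = \<mu> x + n" if "u \<in> g {x}" "v \<in> g {y}" for u v
      using that by (metis set_plus_intro singletonD)
    have "g {x} = {\<mu> x}"
    proof (intro equalityI subsetI)
      fix u assume "u \<in> g {x}"
      then have "u + \<mu> y = \<mu> x + \<mu> y"
        using sum[OF _ \<mu>_mem[OF yK]] \<mu>_mem[OF x] by metis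
      then show "u \<in> {\<mu> x}"
        by simp
    qed (use \<mu>_mem[OF x] in simp)
    then have "{x} = {\<phi> (\<mu> x)}"
      using f_g[of "{x}"] x f_singleton[OF \<mu>H] by simp
    then show "x \<in> \<phi> ` H"
      using \<mu>H by auto
  qed
qed

end

section \<open>From the locale to the class of numerical monoids\<close>

theorem theorem5p9:
  shows "globally_closed TYPE('k) numerical_monoids"
  unfolding globally_closed_def
proof (intro ballI allI impI)
  fix M :: "nat monoid" and K :: "'k monoid"
  assume M: "M \<in> numerical_monoids" and K: "is_semigroup K" and MK: "globally_isomorphic M K"
  obtain H where H: "M = nat_add_monoid\<lparr>carrier := H\<rparr>" "submonoid H nat_add_monoid"
    "finite (UNIV - H)"
    using M unfolding numerical_monoids_def by auto
  have mult: "X <#>\<^bsub>M\<^esub> Y = X + Y" for X Y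
    unfolding H(1) nat_add_monoid_def set_mult_def set_plus_def by auto
  obtain f where f: "f \<in> iso (power_semigroup M) (power_semigroup K)"
    using MK unfolding globally_isomorphic_def is_iso_def by auto
  have carrier: "carrier M = H" unfolding H(1) by simp
  interpret numerical_global_isomorphism H K f
  proof
    show "x + y \<in> H" if "x \<in> H" "y \<in> H" for x y
      using submonoid.m_closed[OF H(2) that] by (simp add: nat_add_monoid_def)
    show "f (X + Y) = f X <#>\<^bsub>K\<^esub> f Y"
      if "X \<subseteq> H" "X \<noteq> {}" "Y \<subseteq> H" "Y \<noteq> {}" for X Y
      using f that unfolding iso_def hom_def power_semigroup_def by (simp add: mult carrier)
    show "bij_betw f {X. X \<subseteq> H \<and> X \<noteq> {}} {X. X \<subseteq> carrier K \<and> X \<noteq> {}}"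
      using f unfolding iso_def power_semigroup_def by (simp add: carrier)
    show "finite (UNIV - H)"
      by (rule H(3))
    show "is_semigroup K"
      by (rule K)
  qed
  have "\<phi> \<in> iso M K"
  proof (rule isoI)
    show "\<phi> \<in> hom M K"
      using \<phi>_closed \<phi>_add by (auto simp: hom_def H(1) nat_add_monoid_def)
    show "bij_betw \<phi> (carrier M) (carrier K)"
      using \<phi>_inj \<phi>_surj by (simp add: bij_betw_def carrier)
  qed
  \<comment> \<open>The required \<open>K'\<close> is \<open>M\<close> itself.\<close>
  then show "\<exists>K'\<in>numerical_monoids. K' \<cong> K"
    using M unfolding is_iso_def by blast
qed

end
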